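(* Let $G$ be a real Lie group acting continuously on a locally compact second countable metrizable space $X$, and let $E$ be a set with a coding map $E\to G$, $e\mapsto g_e$. Suppose that $E$ is finite and that a given Markov chain on $E$ is irreducible. If $x\in X$ and $e\in E$ are such that the random orbit $\{g_{\omega|_n}x : n\in\mathbb{N}\}\subset X$ is infinite for $\mathbb{P}_e$-a.e. $\omega\in E^{\mathbb{N}}$, then the orbit $G_e^+x$ is infinite.
   Context: $\mathbb{P}_e$ is the Markov measure on $\Omega=E^{\mathbb{N}}$ (indices from $0$) started at $\omega_0=e$; $\tau_e(\omega)=\inf\{n\ge1:\omega_n=e\}$. Irreducible: $\mathbb{P}_e[\tau_{e'}<\infty]>0$ for all $e,e'$. For $\omega\in\Omega$, $g_{\omega|_n}=g_{\omega_{n-1}}\cdots g_{\omega_0}$. The renewal measure $\mu_e$ is the law on $G$ of $g_{\omega|_{\tau_e}}=g_{\omega_{\tau_e-1}}\cdots g_{\omega_0}$ under $\mathbb{P}_e$, and $G_e^+$ is the closed subsemigroup of $G$ generated by $\operatorname{supp}(\mu_e)$. *)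

theory Defs
  imports "HOL-Probability.Probability" "HOL-Algebra.Group_Action"
begin

section \<open>Real Lie groups\<close>

text \<open>
  The model space is \<^const>\<open>Euclidean_space\<close> \<open>n\<close>, the functions \<open>nat \<Rightarrow> real\<close> that vanish from
  index \<open>n\<close> on, rather than a type of class \<open>euclidean_space\<close>: such types have positive dimension,
  whereas \<open>n = 0\<close> (discrete groups) has to be allowed.
\<close>

definition partial_deriv :: "nat \<Rightarrow> ((nat \<Rightarrow> real) \<Rightarrow> real) \<Rightarrow> (nat \<Rightarrow> real) \<Rightarrow> real" where
  "partial_deriv i f x = deriv (\<lambda>t. f (x(i := t))) (x i)"

definition iter_partial_deriv ::
    "nat list \<Rightarrow> ((nat \<Rightarrow> real) \<Rightarrow> real) \<Rightarrow> (nat \<Rightarrow> real) \<Rightarrow> real" where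
  "iter_partial_deriv js f = foldr partial_deriv js f"

text \<open>\<open>C\<^sup>\<infinity>\<close> on an open set: all iterated partial derivatives exist and are continuous there.\<close>

definition smooth_fun_on :: "nat \<Rightarrow> (nat \<Rightarrow> real) set \<Rightarrow> ((nat \<Rightarrow> real) \<Rightarrow> real) \<Rightarrow> bool" where
  "smooth_fun_on n U f \<longleftrightarrow>
     openin (Euclidean_space n) U \<and>
     (\<forall>js. set js \<subseteq> {..<n} \<longrightarrow>
        continuous_map (subtopology (Euclidean_space n) U) euclideanreal (iter_partial_deriv js f) \<and>
        (\<forall>i<n. \<forall>x\<in>U. (\<lambda>t. iter_partial_deriv js f (x(i := t))) differentiable (at (x i))))"

definition smooth_vec_fun_on ::
    "nat \<Rightarrow> nat \<Rightarrow> (nat \<Rightarrow> real) set \<Rightarrow> ((nat \<Rightarrow> real) \<Rightarrow> nat \<Rightarrow> real) \<Rightarrow> bool" where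
  "smooth_vec_fun_on n m U F \<longleftrightarrow>
     openin (Euclidean_space n) U \<and>
     F \<in> U \<rightarrow> topspace (Euclidean_space m) \<and>
     (\<forall>k<m. smooth_fun_on n U (\<lambda>x. F x k))"

type_synonym 'a chart = "'a set \<times> ('a \<Rightarrow> nat \<Rightarrow> real)"

definition is_chart :: "nat \<Rightarrow> 'a topology \<Rightarrow> 'a chart \<Rightarrow> bool" where
  "is_chart n T = (\<lambda>(U, \<phi>).
     openin T U \<and> openin (Euclidean_space n) (\<phi> ` U) \<and>
     homeomorphic_map (subtopology T U) (subtopology (Euclidean_space n) (\<phi> ` U)) \<phi>)"

definition smooth_manifold :: "nat \<Rightarrow> 'a topology \<Rightarrow> 'a chart set \<Rightarrow> bool" where
  "smooth_manifold n T A \<longleftrightarrow>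
     Hausdorff_space T \<and> second_countable T \<and>
     (\<forall>c\<in>A. is_chart n T c) \<and>
     (\<Union>(U, \<phi>)\<in>A. U) = topspace T \<and>
     (\<forall>(U, \<phi>)\<in>A. \<forall>(V, \<psi>)\<in>A.
        smooth_vec_fun_on n n (\<phi> ` (U \<inter> V)) (\<lambda>z. \<psi> (inv_into U \<phi> z)))"

text \<open>Charts of a product of an \<open>n\<close>-dimensional manifold with another manifold.\<close>

definition prod_atlas :: "nat \<Rightarrow> 'a chart set \<Rightarrow> 'b chart set \<Rightarrow> ('a \<times> 'b) chart set" where
  "prod_atlas n A B =
     {(U \<times> V, \<lambda>(p, q) i. if i < n then \<phi> p i else \<psi> q (i - n)) | U \<phi> V \<psi>.
        (U, \<phi>) \<in> A \<and> (V, \<psi>) \<in> B}"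

definition smooth_map ::
    "nat \<Rightarrow> 'a topology \<Rightarrow> 'a chart set \<Rightarrow> nat \<Rightarrow> 'b topology \<Rightarrow> 'b chart set \<Rightarrow> ('a \<Rightarrow> 'b) \<Rightarrow> bool"
  where
  "smooth_map n S A m T B F \<longleftrightarrow>
     continuous_map S T F \<and>
     (\<forall>(U, \<phi>)\<in>A. \<forall>(V, \<psi>)\<in>B.
        smooth_vec_fun_on n m (\<phi> ` {p \<in> U. F p \<in> V}) (\<lambda>z. \<psi> (F (inv_into U \<phi> z))))"

definition lie_group :: "('g, 'r) monoid_scheme \<Rightarrow> nat \<Rightarrow> 'g topology \<Rightarrow> 'g chart set \<Rightarrow> bool" where
  "lie_group G n T A \<longleftrightarrow>
     group G \<and> topspace T = carrier G \<and> smooth_manifold n T A \<and>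
     smooth_map (n + n) (prod_topology T T) (prod_atlas n A A) n T A
       (\<lambda>(g, h). g \<otimes>\<^bsub>G\<^esub> h) \<and>
     smooth_map n T A n T A (\<lambda>g. inv\<^bsub>G\<^esub> g)"

definition continuous_action ::
    "('g, 'r) monoid_scheme \<Rightarrow> 'g topology \<Rightarrow> 'x topology \<Rightarrow> ('g \<Rightarrow> 'x \<Rightarrow> 'x) \<Rightarrow> bool" where
  "continuous_action G T X act \<longleftrightarrow>
     group_action G (topspace X) act \<and>
     continuous_map (prod_topology T X) X (\<lambda>(g, x). act g x)"

definition closed_subsemigroup_generated ::
    "('g, 'r) monoid_scheme \<Rightarrow> 'g topology \<Rightarrow> 'g set \<Rightarrow> 'g set" where
  "closed_subsemigroup_generated G T S =
     \<Inter>{H. S \<subseteq> H \<and> H \<subseteq> carrier G \<and> closedin T H \<and> (\<forall>a\<in>H. \<forall>b\<in>H. a \<otimes>\<^bsub>G\<^esub> b \<in> H)}"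


section \<open>Measures on topological spaces\<close>

definition borel_on :: "'a topology \<Rightarrow> 'a measure" where
  "borel_on T = sigma (topspace T) {U. openin T U}"

definition supp :: "'a topology \<Rightarrow> 'a measure \<Rightarrow> 'a set" where
  "supp T \<mu> = {x \<in> topspace T. \<forall>U. openin T U \<and> x \<in> U \<longrightarrow> emeasure \<mu> U > 0}"


section \<open>Markov chains\<close>

text \<open>
  A Markov chain on the discrete state space \<open>'e\<close> is given by its transition probabilities
  \<open>K :: 'e \<Rightarrow> 'e pmf\<close>. The Markov measure started at \<open>e\<close> is obtained from the Ionescu-Tulcea
  theorem; \<open>emeasure_markov_measure_cylinder\<close> below is its usual characterisation.
\<close>

definition markov_step :: "('e \<Rightarrow> 'e pmf) \<Rightarrow> 'e \<Rightarrow> nat \<Rightarrow> (nat \<Rightarrow> 'e) \<Rightarrow> 'e measure" where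
  "markov_step K e n \<omega> =
     (case n of 0 \<Rightarrow> measure_pmf (return_pmf e) | Suc m \<Rightarrow> measure_pmf (K (\<omega> m)))"

definition markov_measure :: "('e \<Rightarrow> 'e pmf) \<Rightarrow> 'e \<Rightarrow> (nat \<Rightarrow> 'e) measure" where
  "markov_measure K e =
     projective_family.lim UNIV
       (Ionescu_Tulcea.CI (markov_step K e) (\<lambda>_. count_space UNIV)) (\<lambda>_. count_space UNIV)"

lemma Ionescu_Tulcea_markov_step:
  fixes K :: "'e \<Rightarrow> 'e pmf"
  shows "Ionescu_Tulcea (markov_step K e) (\<lambda>_. count_space UNIV)"
proof (rule Ionescu_Tulcea.intro)
  fix i :: nat
  show "markov_step K e i \<in> measurable (PiM {0..<i} (\<lambda>_. count_space UNIV))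
          (subprob_algebra (count_space UNIV))"
  proof (cases i)
    case 0
    then show ?thesis
      by (auto simp: markov_step_def[abs_def] intro!: measurable_const measure_pmf_in_subprob_algebra)
  next
    case (Suc m)
    have "(\<lambda>\<omega>. measure_pmf (K (\<omega> m))) \<in> measurable (PiM {0..<Suc m} (\<lambda>_. count_space UNIV))
            (subprob_algebra (count_space UNIV))"
      by (rule measurable_compose[OF measurable_component_singleton[of m]])
         (auto intro: measure_pmf_in_subprob_algebra)
    with Suc show ?thesis
      by (simp add: markov_step_def[abs_def])
  qed
next
  fix i :: nat and x :: "nat \<Rightarrow> 'e"
  show "prob_space (markov_step K e i x)"
    by (auto simp: markov_step_def split: nat.split intro: measure_pmf.prob_space_axioms)
qed

lemma sets_markov_measure: "sets (markov_measure K e) = sets (PiM UNIV (\<lambda>_. count_space UNIV))"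
proof -
  interpret Ionescu_Tulcea "markov_step K e" "\<lambda>_. count_space UNIV"
    by (rule Ionescu_Tulcea_markov_step)
  show ?thesis
    unfolding markov_measure_def by (rule PF.sets_lim)
qed

lemma space_markov_measure: "space (markov_measure K e) = UNIV"
  using sets_eq_imp_space_eq[OF sets_markov_measure, of K e] by (simp add: space_PiM)

lemma emeasure_markov_measure_cylinder:
  fixes K :: "'e \<Rightarrow> 'e pmf"
  shows "emeasure (markov_measure K e) {\<omega>. \<forall>i\<le>n. \<omega> i = a i} =
     (if a 0 = e then ennreal (\<Prod>i<n. pmf (K (a i)) (a (Suc i))) else 0)"
proof -
  let ?M = "\<lambda>_::nat. count_space (UNIV :: 'e set)"
  interpret Ionescu_Tulcea "markov_step K e" ?M
    by (rule Ionescu_Tulcea_markov_step)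
  define S where "S n = (\<Pi>\<^sub>E i\<in>{0..<n}. {a i})" for n
  have S_sets: "S n \<in> sets (PiM {0..<n} ?M)" for n
    unfolding S_def by (intro sets_PiM_I_finite) auto
  have u: "(\<lambda>_. undefined) \<in> space (PiM {0..<0} ?M)"
    by (simp add: space_PiM)
  have C: "emeasure (C 0 n (\<lambda>_. undefined)) (S n) = (\<Prod>i<n. emeasure (markov_step K e i a) {a i})"
    for n
  proof (induction n)
    case 0
    show ?case
      using S_sets[of 0] by (simp add: S_def)
  next
    case (Suc n)
    have step: "emeasure (eP n \<omega>) (S (Suc n)) =
        emeasure (markov_step K e n a) {a n} * indicator (S n) \<omega>"
      if \<omega>: "\<omega> \<in> space (PiM {0..<n} ?M)" for \<omega>
    proof -
      have ext: "\<omega> \<in> extensional {0..<n}"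
        using \<omega> by (auto simp: space_PiM PiE_def)
      have "emeasure (eP n \<omega>) (S (Suc n)) =
          emeasure (markov_step K e n \<omega>) (fun_upd \<omega> n -` S (Suc n) \<inter> space (?M n))"
        by (rule emeasure_eP[OF \<omega> S_sets])
      also have "fun_upd \<omega> n -` S (Suc n) \<inter> space (?M n) = (if \<omega> \<in> S n then {a n} else {})"
        using ext by (auto simp: S_def PiE_iff extensional_def less_Suc_eq split: if_splits)
      also have "emeasure (markov_step K e n \<omega>) (if \<omega> \<in> S n then {a n} else {}) =
          emeasure (markov_step K e n a) {a n} * indicator (S n) \<omega>"
        by (auto simp: markov_step_def S_def PiE_iff split: nat.split)
      finally show ?thesis .
    qed
    have "emeasure (C 0 (Suc n) (\<lambda>_. undefined)) (S (Suc n)) =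
        (\<integral>\<^sup>+\<omega>. emeasure (eP n \<omega>) (S (Suc n)) \<partial>C 0 n (\<lambda>_. undefined))"
      using space_C[OF u, of n] prob_space.not_empty[OF prob_space_C[OF u, of n]]
        measurable_eP[of n] S_sets[of "Suc n"] sets_C[OF u, of n]
      by (simp, subst emeasure_bind[where N="PiM {0..<Suc n} ?M"])
         (auto cong: measurable_cong_sets)
    also have "\<dots> = (\<integral>\<^sup>+\<omega>. emeasure (markov_step K e n a) {a n} * indicator (S n) \<omega>
        \<partial>C 0 n (\<lambda>_. undefined))"
      using space_C[OF u, of n] by (intro nn_integral_cong step) simp
    also have "\<dots> = emeasure (markov_step K e n a) {a n} * emeasure (C 0 n (\<lambda>_. undefined)) (S n)"
      using S_sets[of n] sets_C[OF u, of n] by (intro nn_integral_cmult_indicator) simp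
    finally show ?case
      by (simp add: Suc.IH mult.commute)
  qed
  have "{\<omega>. \<forall>i\<le>n. \<omega> i = a i} = PF.emb UNIV {0..<Suc n} (S (Suc n))"
    by (auto simp: S_def prod_emb_def space_PiM PiE_iff less_Suc_eq_le)
  then have "emeasure (markov_measure K e) {\<omega>. \<forall>i\<le>n. \<omega> i = a i} =
      emeasure (CI {0..<Suc n}) (S (Suc n))"
    unfolding markov_measure_def using lim[OF _ S_sets] by simp
  also have "\<dots> = emeasure (C 0 (Suc n) (\<lambda>_. undefined)) (PF.emb {0..<Suc n} {0..<Suc n} (S (Suc n)))"
    by (rule emeasure_CI[OF subset_refl S_sets])
  also have "PF.emb {0..<Suc n} {0..<Suc n} (S (Suc n)) = S (Suc n)"
    by (rule prod_emb_id) (auto simp: S_def PiE_iff)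
  also have "emeasure (C 0 (Suc n) (\<lambda>_. undefined)) (S (Suc n)) =
      emeasure (markov_step K e 0 a) {a 0} * (\<Prod>i<n. emeasure (markov_step K e (Suc i) a) {a (Suc i)})"
    by (simp only: C prod.lessThan_Suc_shift)
  also have "\<dots> = (if a 0 = e then ennreal (\<Prod>i<n. pmf (K (a i)) (a (Suc i))) else 0)"
    by (auto simp: markov_step_def emeasure_pmf_single prod_ennreal)
  finally show ?thesis .
qed

definition hitting_time :: "'e \<Rightarrow> (nat \<Rightarrow> 'e) \<Rightarrow> enat" where
  "hitting_time e \<omega> = Inf (enat ` {n. n \<ge> 1 \<and> \<omega> n = e})"

definition irreducible_chain :: "('e \<Rightarrow> 'e pmf) \<Rightarrow> bool" where
  "irreducible_chain K \<longleftrightarrow>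
     (\<forall>e e'. emeasure (markov_measure K e) {\<omega>. hitting_time e' \<omega> < \<infinity>} > 0)"

text \<open>\<open>walk G g \<omega> n\<close> is the product \<open>g\<^bsub>\<omega>(n-1)\<^esub> \<cdots> g\<^bsub>\<omega>(0)\<^esub>\<close>.\<close>

primrec walk :: "('g, 'r) monoid_scheme \<Rightarrow> ('e \<Rightarrow> 'g) \<Rightarrow> (nat \<Rightarrow> 'e) \<Rightarrow> nat \<Rightarrow> 'g" where
  "walk G g \<omega> 0 = \<one>\<^bsub>G\<^esub>"
| "walk G g \<omega> (Suc n) = g (\<omega> n) \<otimes>\<^bsub>G\<^esub> walk G g \<omega> n"

text \<open>
  The product up to time \<open>\<tau>\<^sub>e\<close> makes sense only where \<open>\<tau>\<^sub>e\<close> is finite, hence the restriction. For an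
  irreducible chain on a finite set that event has probability 1.
\<close>

definition renewal_measure ::
    "('g, 'r) monoid_scheme \<Rightarrow> 'g topology \<Rightarrow> ('e \<Rightarrow> 'g) \<Rightarrow> ('e \<Rightarrow> 'e pmf) \<Rightarrow> 'e \<Rightarrow> 'g measure" where
  "renewal_measure G T g K e =
     distr (restrict_space (markov_measure K e) {\<omega>. hitting_time e \<omega> < \<infinity>}) (borel_on T)
       (\<lambda>\<omega>. walk G g \<omega> (the_enat (hitting_time e \<omega>)))"

definition renewal_semigroup ::
    "('g, 'r) monoid_scheme \<Rightarrow> 'g topology \<Rightarrow> ('e \<Rightarrow> 'g) \<Rightarrow> ('e \<Rightarrow> 'e pmf) \<Rightarrow> 'e \<Rightarrow> 'g set" where
  "renewal_semigroup G T g K e =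
     closed_subsemigroup_generated G T (supp T (renewal_measure G T g K e))"

end

theory Submission
  imports Defs
begin

text \<open>
  Fix for every state \<open>f\<close> a path of positive probability from \<open>f\<close> to \<open>e\<close>, with product \<open>h\<^sub>f\<close>.
  Almost surely every step of \<open>\<omega>\<close> has positive probability; following \<open>\<omega>\<close> up to time \<open>n\<close> and
  then the fixed path from \<open>f = \<omega> n\<close> gives a loop at \<open>e\<close>. Cut at its visits to \<open>e\<close>, this loop is a
  concatenation of first-return loops of positive probability, whose products lie in the support of
  the renewal measure. Hence the orbit point at time \<open>n\<close> lies in \<open>h\<^sub>f\<^sup>-\<^sup>1 (G\<^sub>e\<^sup>+ x)\<close>, and a finite
  \<open>G\<^sub>e\<^sup>+ x\<close> would leave only finitely many orbit points.
\<close>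

text \<open>The initial state is left free, so that the property passes to the tail of a path when a
  loop is cut.\<close>

definition admissible :: "('e \<Rightarrow> 'e pmf) \<Rightarrow> (nat \<Rightarrow> 'e) \<Rightarrow> nat \<Rightarrow> bool" where
  "admissible K \<omega> n \<longleftrightarrow> (\<forall>i<n. pmf (K (\<omega> i)) (\<omega> (Suc i)) > 0)"

section \<open>First visits and partial products along a path\<close>

lemma hitting_time_finite_iff: "hitting_time e \<omega> < \<infinity> \<longleftrightarrow> (\<exists>n\<ge>1. \<omega> n = e)"
proof
  assume "hitting_time e \<omega> < \<infinity>"
  \<comment> \<open>In \<open>enat\<close> the infimum of the empty set is \<infinity>.\<close>
  then have "enat ` {n. n \<ge> 1 \<and> \<omega> n = e} \<noteq> {}"
    unfolding hitting_time_def by (metis Inf_enat_def less_irrefl)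
  then show "\<exists>n\<ge>1. \<omega> n = e"
    by auto
next
  assume "\<exists>n\<ge>1. \<omega> n = e"
  then obtain n where "n \<ge> 1" "\<omega> n = e"
    by auto
  then have "hitting_time e \<omega> \<le> enat n"
    unfolding hitting_time_def by (intro Inf_lower) auto
  then show "hitting_time e \<omega> < \<infinity>"
    using enat_ord_simps(4) order_le_less_trans by blast
qed

lemma hitting_time_eqI:
  assumes "n \<ge> 1" "\<omega> n = e" "\<And>m. 1 \<le> m \<Longrightarrow> m < n \<Longrightarrow> \<omega> m \<noteq> e"
  shows "hitting_time e \<omega> = enat n"
  unfolding hitting_time_def
proof (rule antisym)
  show "Inf (enat ` {n. n \<ge> 1 \<and> \<omega> n = e}) \<le> enat n"
    using assms by (intro Inf_lower) auto
  show "enat n \<le> Inf (enat ` {n. n \<ge> 1 \<and> \<omega> n = e})"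
  proof (rule Inf_greatest)
    fix k assume "k \<in> enat ` {n. n \<ge> 1 \<and> \<omega> n = e}"
    then obtain m where "k = enat m" "m \<ge> 1" "\<omega> m = e"
      by blast
    with assms(3)[of m] show "enat n \<le> k"
      by (cases "m < n") auto
  qed
qed

lemma first_visit:
  fixes \<omega> :: "nat \<Rightarrow> 'e"
  assumes "n \<ge> 1" "\<omega> n = e"
  shows "\<exists>m. 1 \<le> m \<and> m \<le> n \<and> \<omega> m = e \<and> (\<forall>k. 1 \<le> k \<longrightarrow> k < m \<longrightarrow> \<omega> k \<noteq> e)"
proof -
  define m where "m = (LEAST m. 1 \<le> m \<and> \<omega> m = e)"
  have "1 \<le> m \<and> \<omega> m = e"
    unfolding m_def by (rule LeastI[of _ n]) (use assms in auto)
  moreover have "m \<le> n"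
    unfolding m_def by (rule Least_le) (use assms in auto)
  moreover have "\<omega> k \<noteq> e" if "1 \<le> k" "k < m" for k
    using not_less_Least[of k "\<lambda>m. 1 \<le> m \<and> \<omega> m = e"] that unfolding m_def by auto
  ultimately show ?thesis
    by blast
qed

lemma walk_cong:
  assumes "\<And>i. i < n \<Longrightarrow> \<omega> i = \<omega>' i"
  shows "walk G g \<omega> n = walk G g \<omega>' n"
  using assms by (induction n) auto

lemma walk_closed:
  assumes "group G" "g \<in> UNIV \<rightarrow> carrier G"
  shows "walk G g \<omega> n \<in> carrier G"
proof -
  interpret group G by fact
  show ?thesis
    using assms(2) by (induction n) auto
qed

text \<open>New letters multiply from the left, so the later segment becomes the left
  factor.\<close>

lemma walk_add:
  assumes "group G" "g \<in> UNIV \<rightarrow> carrier G"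
  shows "walk G g \<omega> (m + n) = walk G g (\<lambda>i. \<omega> (m + i)) n \<otimes>\<^bsub>G\<^esub> walk G g \<omega> m"
proof -
  interpret group G by fact
  have "g a \<in> carrier G" for a
    using assms(2) by auto
  then show ?thesis
    by (induction n) (auto simp: walk_closed[OF assms] m_assoc)
qed

section \<open>Events determined by finitely many coordinates\<close>

lemma finitely_determined_eq_UN_cylinders:
  fixes Q :: "(nat \<Rightarrow> 'e::finite) \<Rightarrow> bool"
  assumes "\<forall>\<omega> \<omega>'. (\<forall>i\<le>n. \<omega> i = \<omega>' i) \<longrightarrow> Q \<omega> \<longrightarrow> Q \<omega>'"
  shows "\<exists>I. finite I \<and> I \<subseteq> Collect Q \<and> {\<omega>. Q \<omega>} = (\<Union>a\<in>I. {\<omega>. \<forall>i\<le>n. \<omega> i = a i})"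
proof -
  \<comment> \<open>Over a finite state set there are finitely many words of length
    \<open>Suc n\<close>. Each is read as a sequence by \<open>xs ! i\<close>; the unspecified
    values beyond index \<open>n\<close> are harmless because \<open>Q\<close> sees only the
    coordinates up to \<open>n\<close>.\<close>
  define I where "I = (\<lambda>xs i. xs ! i) ` {xs :: 'e list. length xs = Suc n} \<inter> Collect Q"
  have "finite {xs :: 'e list. set xs \<subseteq> UNIV \<and> length xs = Suc n}"
    by (rule finite_lists_length_eq) simp
  then have "finite I"
    unfolding I_def by simp
  moreover have "I \<subseteq> Collect Q"
    unfolding I_def by blast
  moreover have "{\<omega>. Q \<omega>} = (\<Union>a\<in>I. {\<omega>. \<forall>i\<le>n. \<omega> i = a i})"
  proof (intro equalityI subsetI)
    fix \<omega> assume "\<omega> \<in> {\<omega>. Q \<omega>}"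
    then have "Q \<omega>" by simp
    define xs where "xs = map \<omega> [0..<Suc n]"
    have xs: "length xs = Suc n" "\<And>i. i \<le> n \<Longrightarrow> \<omega> i = xs ! i"
      unfolding xs_def by (auto simp del: upt_Suc simp: nth_map_upt)
    have "Q (\<lambda>i. xs ! i)"
      using assms[rule_format, of \<omega>] xs(2) \<open>Q \<omega>\<close> by blast
    then have "(\<lambda>i. xs ! i) \<in> I"
      using xs(1) unfolding I_def by auto
    then show "\<omega> \<in> (\<Union>a\<in>I. {\<omega>. \<forall>i\<le>n. \<omega> i = a i})"
      using xs(2) by (intro UN_I[of "\<lambda>i. xs ! i"]) auto
  next
    fix \<omega> assume "\<omega> \<in> (\<Union>a\<in>I. {\<omega>. \<forall>i\<le>n. \<omega> i = a i})"
    then obtain a where "Q a" "\<forall>i\<le>n. \<omega> i = a i"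
      unfolding I_def by auto
    then show "\<omega> \<in> {\<omega>. Q \<omega>}"
      using assms[rule_format, of a \<omega>] by auto
  qed
  ultimately show ?thesis
    by blast
qed

lemma cylinder_sets: "{\<omega>. \<forall>i\<le>n. \<omega> i = a i} \<in> sets (markov_measure K e)"
proof -
  have "{\<omega> \<in> space (PiM UNIV (\<lambda>_. count_space UNIV)). \<forall>i\<in>{..n}. \<omega> i = a i}
      \<in> sets (PiM (UNIV :: nat set) (\<lambda>_. count_space (UNIV :: 'a set)))"
    by measurable
  then show ?thesis
    by (simp add: sets_markov_measure space_PiM Ball_def)
qed

lemma finitely_determined_sets:
  fixes K :: "'e::finite \<Rightarrow> 'e pmf"
  assumes "\<forall>\<omega> \<omega>'. (\<forall>i\<le>n. \<omega> i = \<omega>' i) \<longrightarrow> Q \<omega> \<longrightarrow> Q \<omega>'"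
  shows "{\<omega>. Q \<omega>} \<in> sets (markov_measure K e)"
proof -
  obtain I where I: "finite I" "{\<omega>. Q \<omega>} = (\<Union>a\<in>I. {\<omega>. \<forall>i\<le>n. \<omega> i = a i})"
    using finitely_determined_eq_UN_cylinders[of n Q, OF assms] by blast
  show ?thesis
    unfolding I(2) using I(1) cylinder_sets by (intro sets.finite_UN) auto
qed

lemma finitely_determined_null_sets:
  fixes K :: "'e::finite \<Rightarrow> 'e pmf"
  assumes "\<forall>\<omega> \<omega>'. (\<forall>i\<le>n. \<omega> i = \<omega>' i) \<longrightarrow> Q \<omega> \<longrightarrow> Q \<omega>'"
    and "\<And>a. Q a \<Longrightarrow> emeasure (markov_measure K e) {\<omega>. \<forall>i\<le>n. \<omega> i = a i} = 0"
  shows "{\<omega>. Q \<omega>} \<in> null_sets (markov_measure K e)"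
proof -
  obtain I where I: "finite I" "I \<subseteq> Collect Q" "{\<omega>. Q \<omega>} = (\<Union>a\<in>I. {\<omega>. \<forall>i\<le>n. \<omega> i = a i})"
    using finitely_determined_eq_UN_cylinders[of n Q, OF assms(1)] by blast
  show ?thesis
    unfolding I(3) using I(1,2) cylinder_sets assms(2) by (intro null_sets.finite_UN null_setsI) auto
qed

section \<open>Almost sure properties and paths of positive probability\<close>

text \<open>A failure up to time \<open>n\<close> lies in finitely many cylinders, each with a wrong
  start or a zero factor in its product formula. Then countably many \<open>n\<close> are
  combined.\<close>

lemma AE_admissible:
  fixes K :: "'e::finite \<Rightarrow> 'e pmf"
  shows "AE \<omega> in markov_measure K e. \<omega> 0 = e \<and> (\<forall>n. admissible K \<omega> n)"
proof -
  have "AE \<omega> in markov_measure K e. \<omega> 0 = e \<and> admissible K \<omega> n" for n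
  proof (rule AE_I')
    show "{\<omega>. \<not> (\<omega> 0 = e \<and> admissible K \<omega> n)} \<in> null_sets (markov_measure K e)"
    proof (rule finitely_determined_null_sets[where n = n])
      fix a assume "\<not> (a 0 = e \<and> admissible K a n)"
      then consider "a 0 \<noteq> e" | i where "i < n" "pmf (K (a i)) (a (Suc i)) = 0"
        unfolding admissible_def by (metis pmf_pos)
      then show "emeasure (markov_measure K e) {\<omega>. \<forall>i\<le>n. \<omega> i = a i} = 0"
      proof cases
        case 2
        then have prod: "(\<Prod>i<n. pmf (K (a i)) (a (Suc i))) = 0"
          by (intro prod_zero) auto
        show ?thesis
          unfolding emeasure_markov_measure_cylinder prod by simp
      qed (simp add: emeasure_markov_measure_cylinder)
    qed (auto simp: admissible_def)
  qed auto
  then have "AE \<omega> in markov_measure K e. \<forall>n. \<omega> 0 = e \<and> admissible K \<omega> n"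
    by (subst AE_all_countable) blast
  then show ?thesis
    by (rule eventually_mono) blast
qed

lemma markov_measure_AE_ex:
  assumes "AE \<omega> in markov_measure K e. P \<omega>"
  shows "\<exists>\<omega>. P \<omega>"
proof (rule ccontr)
  assume "\<not> ?thesis"
  \<comment> \<open>If \<open>P\<close> held nowhere, every event would be null; the event
    \<open>\<omega> 0 = e\<close> serves as the contradiction, having mass one by the cylinder
    formula with empty product.\<close>
  then have "emeasure (markov_measure K e) {\<omega> \<in> space (markov_measure K e). \<forall>i\<le>0. \<omega> i = e} = 0"
    using assms by (intro emeasure_eq_0_AE) (rule eventually_mono, auto)
  then show False
    using emeasure_markov_measure_cylinder[of K e 0 "\<lambda>_. e"] by (simp add: space_markov_measure)
qed

text \<open>The event of hitting \<open>e\<close> has positive mass from \<open>f\<close>, so it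
  cannot avoid the almost sure set of admissible paths; any common path will do.\<close>

lemma irreducible_chain_path:
  fixes K :: "'e::finite \<Rightarrow> 'e pmf"
  assumes "irreducible_chain K"
  shows "\<exists>\<omega> n. n \<ge> 1 \<and> \<omega> 0 = f \<and> \<omega> n = e \<and> admissible K \<omega> n"
proof -
  have "\<exists>\<omega>. \<omega> 0 = f \<and> (\<forall>n. admissible K \<omega> n) \<and> hitting_time e \<omega> < \<infinity>"
  proof (rule ccontr)
    assume "\<not> ?thesis"
    then have "AE \<omega> in markov_measure K f. \<not> hitting_time e \<omega> < \<infinity>"
      by (intro eventually_mono[OF AE_admissible[where K = K and e = f]]) blast
    then have "emeasure (markov_measure K f) {\<omega>. hitting_time e \<omega> < \<infinity>} = 0"
      using emeasure_eq_0_AE[of "\<lambda>\<omega>. hitting_time e \<omega> < \<infinity>" "markov_measure K f"]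
      by (simp add: space_markov_measure)
    then show False
      using assms unfolding irreducible_chain_def by (metis less_irrefl)
  qed
  then show ?thesis
    unfolding hitting_time_finite_iff by blast
qed

section \<open>The support of the renewal measure\<close>

text \<open>Split by the value \<open>n\<close> of the hitting time: each piece depends only on the
  coordinates up to \<open>n\<close>, so it is measurable whatever the set \<open>B\<close>
  is.\<close>

lemma sets_hitting_time_walk:
  fixes K :: "'e::finite \<Rightarrow> 'e pmf"
  shows "{\<omega>. hitting_time e \<omega> < \<infinity> \<and> walk G g \<omega> (the_enat (hitting_time e \<omega>)) \<in> B}
    \<in> sets (markov_measure K e')"
proof -
  define Q where "Q n \<omega> \<longleftrightarrow> n \<ge> 1 \<and> \<omega> n = e \<and> (\<forall>m. 1 \<le> m \<and> m < n \<longrightarrow> \<omega> m \<noteq> e) \<and> walk G g \<omega> n \<in> B"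
    for n \<omega>
  have Q: "hitting_time e \<omega> < \<infinity> \<and> walk G g \<omega> (the_enat (hitting_time e \<omega>)) \<in> B \<longleftrightarrow> (\<exists>n. Q n \<omega>)"
    for \<omega>
  proof
    assume *: "hitting_time e \<omega> < \<infinity> \<and> walk G g \<omega> (the_enat (hitting_time e \<omega>)) \<in> B"
    then obtain n where "n \<ge> 1" "\<omega> n = e"
      unfolding hitting_time_finite_iff by blast
    then obtain m where m: "1 \<le> m" "\<omega> m = e" "\<And>k. 1 \<le> k \<Longrightarrow> k < m \<Longrightarrow> \<omega> k \<noteq> e"
      using first_visit[of n \<omega> e] by auto
    then have "hitting_time e \<omega> = enat m"
      by (rule hitting_time_eqI)
    with * m show "\<exists>n. Q n \<omega>"
      unfolding Q_def by auto
  next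
    assume "\<exists>n. Q n \<omega>"
    then obtain n where n: "Q n \<omega>" ..
    then have "hitting_time e \<omega> = enat n"
      unfolding Q_def by (intro hitting_time_eqI) auto
    with n show "hitting_time e \<omega> < \<infinity> \<and> walk G g \<omega> (the_enat (hitting_time e \<omega>)) \<in> B"
      unfolding Q_def by simp
  qed
  have "{\<omega>. Q n \<omega>} \<in> sets (markov_measure K e')" for n
  proof (rule finitely_determined_sets[where n = n], intro allI impI)
    fix \<omega> \<omega>' :: "nat \<Rightarrow> 'e"
    assume eq: "\<forall>i\<le>n. \<omega> i = \<omega>' i" and "Q n \<omega>"
    moreover have "walk G g \<omega> n = walk G g \<omega>' n"
      by (rule walk_cong) (simp add: eq)
    ultimately show "Q n \<omega>'"
      unfolding Q_def by auto
  qed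
  then have "(\<Union>n. {\<omega>. Q n \<omega>}) \<in> sets (markov_measure K e')"
    by (intro sets.countable_nat_UN) blast
  then show ?thesis
    unfolding Q Collect_ex_eq .
qed

text \<open>The product is an atom of the renewal measure: the cylinder of \<open>\<omega>\<close>
  up to time \<open>n\<close> has positive mass, and on it both the hitting time and the product at
  that time are constant.\<close>

lemma first_return_walk_in_supp:
  fixes K :: "'e::finite \<Rightarrow> 'e pmf"
  assumes G: "group G" "topspace T = carrier G" "g \<in> UNIV \<rightarrow> carrier G"
    and \<omega>: "\<omega> 0 = e" "admissible K \<omega> n"
    and n: "n \<ge> 1" "\<omega> n = e" "\<And>m. 1 \<le> m \<Longrightarrow> m < n \<Longrightarrow> \<omega> m \<noteq> e"
  shows "walk G g \<omega> n \<in> supp T (renewal_measure G T g K e)"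
  unfolding supp_def
proof (intro CollectI conjI allI impI)
  show "walk G g \<omega> n \<in> topspace T"
    by (simp add: G walk_closed)
next
  fix U assume U: "openin T U \<and> walk G g \<omega> n \<in> U"
  define M where "M = markov_measure K e"
  define R where "R = {\<omega>. hitting_time e \<omega> < \<infinity>}"
  define f where "f \<omega> = walk G g \<omega> (the_enat (hitting_time e \<omega>))" for \<omega>
  have spM: "space M = UNIV"
    by (simp add: M_def space_markov_measure)
  have fB: "f -` B \<inter> R \<in> sets M" for B
  proof -
    have "f -` B \<inter> R = {\<omega>. hitting_time e \<omega> < \<infinity> \<and> walk G g \<omega> (the_enat (hitting_time e \<omega>)) \<in> B}"
      by (auto simp: f_def R_def)
    then show ?thesis
      using sets_hitting_time_walk[of e G g B K e] by (simp add: M_def)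
  qed
  have R: "R \<in> sets M"
    using fB[of UNIV] by simp
  have spR: "space (restrict_space M R) = R"
    by (simp add: space_restrict_space spM)
  have spB: "space (borel_on T) = carrier G" "sets (borel_on T) = sigma_sets (carrier G) {U. openin T U}"
    unfolding borel_on_def G(2)[symmetric]
    by (auto intro!: space_measure_of sets_measure_of dest: openin_subset)
  have meas: "f \<in> measurable (restrict_space M R) (borel_on T)"
  proof (rule measurableI)
    show "f \<omega>' \<in> space (borel_on T)" for \<omega>'
      by (simp add: spB f_def walk_closed[OF G(1,3)])
    show "f -` B \<inter> space (restrict_space M R) \<in> sets (restrict_space M R)" for B
      unfolding spR using fB[of B] R by (simp add: sets_restrict_space_iff spM)
  qed
  \<comment> \<open>The cylinder must include coordinate \<open>n\<close>, since the return to
    \<open>e\<close> happens there; its mass is a product of positive transition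
    probabilities.\<close>
  have "0 < emeasure M {\<omega>'. \<forall>i\<le>n. \<omega>' i = \<omega> i}"
    unfolding M_def emeasure_markov_measure_cylinder using \<omega>
    by (auto simp: admissible_def intro!: prod_pos)
  also have "\<dots> \<le> emeasure M (f -` U \<inter> R)"
  proof (rule emeasure_mono[OF _ fB], rule subsetI)
    fix \<omega>' assume "\<omega>' \<in> {\<omega>'. \<forall>i\<le>n. \<omega>' i = \<omega> i}"
    then have eq: "\<And>i. i \<le> n \<Longrightarrow> \<omega>' i = \<omega> i"
      by simp
    have "hitting_time e \<omega>' = enat n"
      using n eq by (intro hitting_time_eqI) auto
    moreover have "walk G g \<omega>' n = walk G g \<omega> n"
      by (rule walk_cong) (simp add: eq)
    ultimately show "\<omega>' \<in> f -` U \<inter> R"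
      using U by (simp add: f_def R_def)
  qed
  also have "\<dots> = emeasure (restrict_space M R) (f -` U \<inter> R)"
    using R by (intro emeasure_restrict_space[symmetric]) (auto simp: spM)
  also have "\<dots> = emeasure (distr (restrict_space M R) (borel_on T) f) U"
    using U by (subst emeasure_distr[OF meas]) (auto simp: spB spR)
  also have "\<dots> = emeasure (renewal_measure G T g K e) U"
    by (simp add: renewal_measure_def M_def R_def f_def[abs_def])
  finally show "0 < emeasure (renewal_measure G T g K e) U" .
qed

section \<open>Loops and the return to the base state\<close>

text \<open>Strong induction on the length: cut at the first return time \<open>m\<close>. The
  initial piece contributes an element of the support, and the rest is a shorter loop at
  \<open>e\<close> because \<open>m \<ge> 1\<close>.\<close>

lemma loop_walk_in_renewal_semigroup:
  fixes K :: "'e::finite \<Rightarrow> 'e pmf"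
  assumes G: "group G" "topspace T = carrier G" "g \<in> UNIV \<rightarrow> carrier G"
    and "\<omega> 0 = e" "admissible K \<omega> n" "n \<ge> 1" "\<omega> n = e"
  shows "walk G g \<omega> n \<in> renewal_semigroup G T g K e"
  using assms(4-)
proof (induction n arbitrary: \<omega> rule: less_induct)
  case (less n)
  obtain m where m: "1 \<le> m" "m \<le> n" "\<omega> m = e" "\<And>k. 1 \<le> k \<Longrightarrow> k < m \<Longrightarrow> \<omega> k \<noteq> e"
    using first_visit[of n \<omega> e] less.prems by auto
  have "walk G g \<omega> m \<in> supp T (renewal_measure G T g K e)"
    using less.prems m by (intro first_return_walk_in_supp[OF G]) (auto simp: admissible_def)
  then have first: "walk G g \<omega> m \<in> renewal_semigroup G T g K e"
    unfolding renewal_semigroup_def closed_subsemigroup_generated_def by blast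
  show ?case
  proof (cases "m = n")
    case True
    with first show ?thesis by simp
  next
    case False
    have "walk G g (\<lambda>i. \<omega> (m + i)) (n - m) \<in> renewal_semigroup G T g K e"
      using m False less.prems by (intro less.IH) (auto simp: admissible_def)
    then have "walk G g (\<lambda>i. \<omega> (m + i)) (n - m) \<otimes>\<^bsub>G\<^esub> walk G g \<omega> m \<in> renewal_semigroup G T g K e"
      using first unfolding renewal_semigroup_def closed_subsemigroup_generated_def by blast
    then show ?thesis
      using walk_add[OF G(1,3), of \<omega> m "n - m"] m(2) by simp
  qed
qed

text \<open>The order of quantifiers is the point: one \<open>h\<close> depending only on the end
  state \<open>f\<close> serves all admissible paths from \<open>e\<close> to \<open>f\<close>, of
  every length.\<close>

lemma exists_return_element:
  fixes K :: "'e::finite \<Rightarrow> 'e pmf"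
  assumes G: "group G" "topspace T = carrier G" "g \<in> UNIV \<rightarrow> carrier G"
    and "irreducible_chain K"
  shows "\<exists>h\<in>carrier G. \<forall>\<omega> n. \<omega> 0 = e \<longrightarrow> admissible K \<omega> n \<longrightarrow> \<omega> n = f \<longrightarrow>
      h \<otimes>\<^bsub>G\<^esub> walk G g \<omega> n \<in> renewal_semigroup G T g K e"
proof -
  obtain b k where b: "k \<ge> 1" "b 0 = f" "b k = e" "admissible K b k"
    using irreducible_chain_path[OF assms(4), of f e] by blast
  show ?thesis
  proof (intro bexI[of _ "walk G g b k"] allI impI)
    show "walk G g b k \<in> carrier G"
      by (rule walk_closed[OF G(1,3)])
    fix \<omega> n assume \<omega>: "\<omega> 0 = e" "admissible K \<omega> n" "\<omega> n = f"
    \<comment> \<open>Concatenation of \<open>\<omega>\<close> up to time \<open>n\<close> with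
      \<open>b\<close>. At the junction both give \<open>f\<close>, so \<open>c_ge\<close> holds
      from \<open>i = 0\<close> on.\<close>
    define c where "c i = (if i \<le> n then \<omega> i else b (i - n))" for i
    have c_le: "c i = \<omega> i" if "i \<le> n" for i
      using that by (simp add: c_def)
    have c_ge: "c (n + i) = b i" for i
      using b \<omega> by (simp add: c_def)
    have "admissible K c (n + k)"
      unfolding admissible_def
    proof (intro allI impI)
      fix i assume i: "i < n + k"
      show "0 < pmf (K (c i)) (c (Suc i))"
      proof (cases "i < n")
        case True
        then show ?thesis
          using \<omega>(2) by (simp add: c_le admissible_def)
      next
        case False
        then obtain j where "i = n + j"
          by (metis add_diff_inverse_nat)
        then show ?thesis
          using b(4) i c_ge[of j] c_ge[of "Suc j"] by (simp add: admissible_def)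
      qed
    qed
    moreover have "c 0 = e" "c (n + k) = e"
      using c_le[of 0] c_ge[of k] \<omega> b by auto
    \<comment> \<open>Since \<open>k \<ge> 1\<close>, the loop has positive length even when
      \<open>n = 0\<close>.\<close>
    ultimately have "walk G g c (n + k) \<in> renewal_semigroup G T g K e"
      using b(1) by (intro loop_walk_in_renewal_semigroup[OF G]) auto
    moreover have "walk G g c n = walk G g \<omega> n"
      by (rule walk_cong) (simp add: c_le)
    ultimately show "walk G g b k \<otimes>\<^bsub>G\<^esub> walk G g \<omega> n \<in> renewal_semigroup G T g K e"
      by (simp add: walk_add[OF G(1,3)] c_ge)
  qed
qed

section \<open>From a finite semigroup orbit to finite random orbits\<close>

theorem lemma3p18:
  fixes G :: "('g, 'r) monoid_scheme" and d :: nat and T :: "'g topology" and A :: "'g chart set"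
    and X :: "'x topology" and act :: "'g \<Rightarrow> 'x \<Rightarrow> 'x"
    and g :: "'e::finite \<Rightarrow> 'g" and K :: "'e \<Rightarrow> 'e pmf"
    and x :: 'x and e :: 'e
  assumes "lie_group G d T A"
    and "locally_compact_space X" and "second_countable X" and "metrizable_space X"
    and "continuous_action G T X act"
    and "g \<in> UNIV \<rightarrow> carrier G"
    and "irreducible_chain K"
    and "x \<in> topspace X"
    and "AE \<omega> in markov_measure K e. infinite {act (walk G g \<omega> n) x | n. True}"
  shows "infinite {act h x | h. h \<in> renewal_semigroup G T g K e}"
proof
  let ?F = "{act h x | h. h \<in> renewal_semigroup G T g K e}"
  assume fin: "finite ?F"
  have G: "group G" "topspace T = carrier G" "g \<in> UNIV \<rightarrow> carrier G"
    using assms(1,6) by (auto simp: lie_group_def)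
  interpret action: group_action G "topspace X" act
    using assms(5) by (simp add: continuous_action_def)
  have "\<forall>f. \<exists>h. h \<in> carrier G \<and> (\<forall>\<omega> n. \<omega> 0 = e \<longrightarrow> admissible K \<omega> n \<longrightarrow> \<omega> n = f \<longrightarrow>
      h \<otimes>\<^bsub>G\<^esub> walk G g \<omega> n \<in> renewal_semigroup G T g K e)"
    using exists_return_element[OF G assms(7)] by blast
  from choice[OF this] obtain h where h: "\<And>f. h f \<in> carrier G"
    "\<And>\<omega> n. \<omega> 0 = e \<Longrightarrow> admissible K \<omega> n \<Longrightarrow>
      h (\<omega> n) \<otimes>\<^bsub>G\<^esub> walk G g \<omega> n \<in> renewal_semigroup G T g K e"
    by blast
  \<comment> \<open>One path suffices: almost every path is admissible and has an infinite orbit, so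
    some path has both properties.\<close>
  obtain \<omega> where \<omega>: "infinite {act (walk G g \<omega> n) x | n. True}" "\<omega> 0 = e" "\<And>n. admissible K \<omega> n"
    using markov_measure_AE_ex[OF AE_conjI[OF assms(9) AE_admissible[where K = K and e = e]]] by auto
  \<comment> \<open>By the composition rule, acting with \<open>h (\<omega> n)\<close> on the orbit
    point is acting on \<open>x\<close> with an element of the renewal semigroup.\<close>
  have "act (walk G g \<omega> n) x \<in> act (h (\<omega> n)) -` ?F \<inter> topspace X" for n
    using action.composition_rule[OF assms(8) h(1) walk_closed[OF G(1,3)], of "\<omega> n" \<omega> n, symmetric]
      h(2)[OF \<omega>(2,3), of n] action.element_image[OF walk_closed[OF G(1,3)] assms(8) refl]
    by auto
  then have "{act (walk G g \<omega> n) x | n. True} \<subseteq> (\<Union>f. act (h f) -` ?F \<inter> topspace X)"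
    by blast
  \<comment> \<open>Each \<open>h f\<close> acts injectively, so the preimage of the finite set
    \<open>?F\<close> is finite; the union runs over the finite state set.\<close>
  moreover have "finite (act (h f) -` ?F \<inter> topspace X)" for f
    by (rule finite_vimage_IntI[OF fin action.inj_prop[OF h(1)]])
  then have "finite (\<Union>f. act (h f) -` ?F \<inter> topspace X)"
    by (intro finite_UN_I) auto
  ultimately show False
    using \<omega>(1) finite_subset by blast
qed

end
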